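(* A parametric solution of the simultaneous diophantine equations \[ x_1^r+x_2^r+x_3^r=y_1^r+y_2^r+y_3^r, \quad r=1, 2, \] is given in terms of six arbitrary parameters $p, q, r, a, b, c$ by \[ \begin{aligned} x_1&=\phi(p, q, r, a, b, c), &x_2&=\phi(p, q, r, b, c, a), &x_3&=\phi(p, q, r, c, a, b),\\ y_1&=\phi(p, q, r, a, c, b), &y_2&=\phi(p, q, r, c, b, a), &y_3&=\phi(p, q, r, b, a, c), \end{aligned} \] where $\phi(f, g, h, u, v, w)=fu+gv+hw$. All integer solutions of the simultaneous diophantine equations $x_1^r+x_2^r+x_3^r=y_1^r+y_2^r+y_3^r$, $r=1,2$, may be generated by taking scalar multiples of this parametric solution $x_1=\phi(p,q,r,a,b,c),\dots,y_3=\phi(p,q,r,b,a,c)$.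
   Context: This concerns ideal solutions of the Tarry-Escott problem of degree 2. In the equations, the exponent $r$ takes the values 1 and 2 (the letter $r$ is also used, separately, as one of the six parameters). *)

theory Defs
  imports Complex_Main
begin

definition phi :: "'a::comm_ring_1 \<Rightarrow> 'a \<Rightarrow> 'a \<Rightarrow> 'a \<Rightarrow> 'a \<Rightarrow> 'a \<Rightarrow> 'a" where
  "phi f g h u v w = f * u + g * v + h * w"

definition te_solution :: "'a::comm_ring_1 \<Rightarrow> 'a \<Rightarrow> 'a \<Rightarrow> 'a \<Rightarrow> 'a \<Rightarrow> 'a \<Rightarrow> bool" where
  "te_solution x1 x2 x3 y1 y2 y3 \<longleftrightarrow>
     (\<forall>n\<in>{1, 2::nat}. x1 ^ n + x2 ^ n + x3 ^ n = y1 ^ n + y2 ^ n + y3 ^ n)"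

end

theory Submission imports Defs begin

text \<open>
  Subtracting \<open>y1 + y2 - x1\<close> from all six unknowns makes \<open>x1 = y1 + y2\<close> and \<open>y3 = x2 + x3\<close>, and the
  quadratic equation becomes \<open>y1 y2 = x2 x3\<close>. The four-number lemma then gives
  \<open>y1 = p a\<close>, \<open>y2 = q b\<close>, \<open>x2 = p b\<close>, \<open>x3 = q a\<close>, which is the parametric solution with
  \<open>r = c = 0\<close>. Adding \<open>t\<close> to \<open>p, q, r\<close> and \<open>u\<close> to \<open>a, b, c\<close> adds
  \<open>t (a + b) + u (p + q) + 3 t u\<close> to all six forms; choosing \<open>u\<close> with
  \<open>a + b + 3 u \<noteq> 0\<close>, we can solve for a rational \<open>t\<close> that undoes the translation.
\<close>

text \<open>Since \<open>w\<close> divides \<open>y * z\<close>, it splits as \<open>p * a\<close>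
  with \<open>p\<close> dividing \<open>y\<close> and \<open>a\<close> dividing \<open>z\<close>;
  the cofactors are \<open>b\<close> and \<open>q\<close>, and cancelling \<open>w\<close> gives
  \<open>x\<close>.\<close>

lemma four_number:
  fixes w x y z :: "'a::semiring_gcd"
  assumes "w * x = y * z"
  obtains p q a b where "w = p * a" "x = q * b" "y = p * b" "z = q * a"
proof (cases "w = 0")
  case True
  then consider "y = 0" | "z = 0"
    using assms by auto
  then show ?thesis
  proof cases
    case 1
    with True show ?thesis by (intro that[of 0 z 1 x]) auto
  next
    case 2
    with True show ?thesis by (intro that[of y 0 x 1]) auto
  qed
next
  case False
  have "w dvd y * z"
    using assms by (metis dvd_triv_left)
  then obtain p a where w: "w = p * a" and "p dvd y" "a dvd z"
    using division_decomp by blast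
  then obtain b q where "y = p * b" "z = q * a"
    by (metis dvdE mult.commute)
  moreover from this have "w * x = w * (q * b)"
    using assms w by (simp add: ac_simps)
  ultimately show ?thesis
    using w False by (intro that[of p a q b]) auto
qed

lemma te_solution_phi:
  "te_solution (phi p q r a b c) (phi p q r b c a) (phi p q r c a b)
               (phi p q r a c b) (phi p q r c b a) (phi p q r b a c)"
  by (simp add: te_solution_def phi_def power2_eq_square algebra_simps)

lemma te_solution_translated_product:
  fixes x1 x2 x3 y1 y2 y3 :: int
  assumes "te_solution x1 x2 x3 y1 y2 y3"
  defines "s \<equiv> y1 + y2 - x1"
  shows "(y1 - s) * (y2 - s) = (x2 - s) * (x3 - s)"
proof -
  have lin: "y3 = x1 + x2 + x3 - y1 - y2"
    and quad: "x1\<^sup>2 + x2\<^sup>2 + x3\<^sup>2 = y1\<^sup>2 + y2\<^sup>2 + y3\<^sup>2"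
    using assms(1) by (simp_all add: te_solution_def)
  \<comment> \<open>After the shift the squares cancel; only the cross terms remain, hence the
    factor 2.\<close>
  have "2 * ((y1 - s) * (y2 - s)) = 2 * ((x2 - s) * (x3 - s))"
    using quad unfolding s_def lin
    by (simp add: power2_eq_square algebra_simps)
  then show ?thesis by simp
qed

lemma te_solution_int_parametrization:
  fixes x1 x2 x3 y1 y2 y3 :: int
  assumes "te_solution x1 x2 x3 y1 y2 y3"
  obtains m p q r a b c :: int where "m \<noteq> 0"
    "m * x1 = phi p q r a b c" "m * x2 = phi p q r b c a" "m * x3 = phi p q r c a b"
    "m * y1 = phi p q r a c b" "m * y2 = phi p q r c b a" "m * y3 = phi p q r b a c"
proof -
  define s where "s = y1 + y2 - x1"
  obtain p q a b where pqab: "y1 - s = p * a" "y2 - s = q * b" "x2 - s = p * b" "x3 - s = q * a"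
    by (rule four_number[OF te_solution_translated_product[OF assms, folded s_def]])
  have "x1 + x2 + x3 = y1 + y2 + y3"
    using assms by (simp add: te_solution_def)
  with pqab have eqs: "y1 = p * a + s" "y2 = q * b + s" "x2 = p * b + s" "x3 = q * a + s"
    "x1 = p * a + q * b + s" "y3 = p * b + q * a + s"
    unfolding s_def by linarith+
  \<comment> \<open>If \<open>a + b = -3\<close>, then \<open>u = 0\<close> gives
    \<open>m = -3\<close>; otherwise \<open>u = 1\<close> gives
    \<open>m = a + b + 3\<close>.\<close>
  define u :: int where "u = (if a + b + 3 = 0 then 0 else 1)"
  define m where "m = a + b + 3 * u"
  have "m \<noteq> 0"
    by (auto simp: m_def u_def)
  \<comment> \<open>The shift \<open>t\<close> must satisfy \<open>t * m + u * (p + q) = s\<close>,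
    so \<open>t = n / m\<close>. Multiplying \<open>p + t\<close>, \<open>q + t\<close> and
    \<open>t\<close> by \<open>m\<close> clears the denominator.\<close>
  define n where "n = s - u * (p + q)"
  show ?thesis
    by (rule that[of m "m * p + n" "m * q + n" n "a + u" "b + u" u])
      (fact, simp_all add: eqs phi_def n_def m_def algebra_simps)
qed

theorem theorem1:
  "(\<forall>p q r a b c :: 'a::comm_ring_1.
      te_solution (phi p q r a b c) (phi p q r b c a) (phi p q r c a b)
                  (phi p q r a c b) (phi p q r c b a) (phi p q r b a c)) \<and>
   (\<forall>x1 x2 x3 y1 y2 y3 :: int. te_solution x1 x2 x3 y1 y2 y3 \<longrightarrow>
      (\<exists>(k::rat) (p::int) (q::int) (r::int) (a::int) (b::int) (c::int).
         of_int x1 = k * of_int (phi p q r a b c) \<and>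
         of_int x2 = k * of_int (phi p q r b c a) \<and>
         of_int x3 = k * of_int (phi p q r c a b) \<and>
         of_int y1 = k * of_int (phi p q r a c b) \<and>
         of_int y2 = k * of_int (phi p q r c b a) \<and>
         of_int y3 = k * of_int (phi p q r b a c)))"
proof (intro conjI allI impI)
  fix p q r a b c :: 'a
  show "te_solution (phi p q r a b c) (phi p q r b c a) (phi p q r c a b)
                    (phi p q r a c b) (phi p q r c b a) (phi p q r b a c)"
    by (rule te_solution_phi)
next
  fix x1 x2 x3 y1 y2 y3 :: int
  assume "te_solution x1 x2 x3 y1 y2 y3"
  then obtain m p q r a b c :: int where "m \<noteq> 0" and eqs:
    "m * x1 = phi p q r a b c" "m * x2 = phi p q r b c a" "m * x3 = phi p q r c a b"
    "m * y1 = phi p q r a c b" "m * y2 = phi p q r c b a" "m * y3 = phi p q r b a c"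
    by (rule te_solution_int_parametrization)
  have div: "of_int x = (1 / of_int m :: rat) * of_int v" if "m * x = v" for x v
    using \<open>m \<noteq> 0\<close> by (simp flip: that)
  show "\<exists>(k::rat) (p::int) (q::int) (r::int) (a::int) (b::int) (c::int).
         of_int x1 = k * of_int (phi p q r a b c) \<and>
         of_int x2 = k * of_int (phi p q r b c a) \<and>
         of_int x3 = k * of_int (phi p q r c a b) \<and>
         of_int y1 = k * of_int (phi p q r a c b) \<and>
         of_int y2 = k * of_int (phi p q r c b a) \<and>
         of_int y3 = k * of_int (phi p q r b a c)"
    using eqs[THEN div] by blast
qed

end
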